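(* Let $V=f+g-h$ satisfy the standing assumptions (a)–(e) of the context, let $\lambda\in(0,\min\{\bar\lambda,1/L\})$, and suppose that $D_i(f)$ is a regular closed set, that is, $D_i(f)=\mathrm{cl}(\mathrm{int}(D_i(f)))$, for any $i\in I$. Then any fixed point of $T^\lambda_{\rm PDMC}$ is a critical point of $f+g-h$.
   Context: $\mathbb{E}$ is a Euclidean space with inner product $\langle\cdot,\cdot\rangle$ and norm $\|\cdot\|$. A function $q$ is $\rho$-convex ($\rho\in\mathbb{R}$) if $q-\frac{\rho}{2}\|\cdot\|^2$ is convex. $\mathrm{dom}(q)=\{w:q(w)<+\infty\}$. $\mathrm{cl}$ and $\mathrm{int}$ denote closure and interior. A fixed point of $T$ is a $w$ with $w\in T(w)$. Standing assumptions: (a) $f=\min_{i\in I}f_i$, $g=\min_{j\in J}g_j$, $h=\max_{m\in M}h_m$ with $I,J,M$ finite index sets. (b) For each $i\in I$, $f_i:\mathbb{E}\to\mathbb{R}$ has $L_i$-Lipschitz continuous gradient in $\mathbb{E}$ for some $L_i>0$; put $L=\max_{i\in I}L_i$. (c) For each $j\in J$, $g_j:\mathbb{E}\to\mathbb{R}\cup\{+\infty\}$ is proper and $\rho$-convex (with common $\rho\in\mathbb{R}$), $\mathrm{dom}(g_j)$ is closed, and $g_j$ is continuous in $\mathrm{dom}(g_j)$. (d) For each $m\in M$, $h_m:\mathbb{E}\to\mathbb{R}$ is a continuously differentiable convex function. (e) For all $(i,j,m)\in I\times J\times M$, $f_i+g_j-h_m$ is coercive over $\mathbb{E}$. $\bar\lambda=-1/\rho$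 if $\rho<0$ and $\bar\lambda=+\infty$ if $\rho\ge0$. Operator: $D_i(f)=\{w\in\mathbb{E}: f(w)=f_i(w)\}$, $D_m(h)=\{w\in\mathbb{E}: h(w)=h_m(w)\}$, $f'(w)=\{\nabla f_i(w): i\in I,\ w\in D_i(f)\}$, $h'(w)=\{\nabla h_m(w): m\in M,\ w\in D_m(h)\}$, $\mathrm{prox}_{\lambda g}(w)=\arg\min_{z\in\mathbb{E}}\{g(z)+\frac{1}{2\lambda}\|z-w\|^2\}$ (possibly set-valued), and $$T^\lambda_{\rm PDMC}(w)=\bigcup_{u\in f'(w),\,v\in h'(w)}\mathrm{prox}_{\lambda g}(w-\lambda u+\lambda v).$$ Subdifferential: $\hat\partial q(\bar w)=\{v\in\mathbb{E}: q(z)\ge q(\bar w)+\langle v,z-\bar w\rangle+o(\|z-\bar w\|)\}$ and $\partial q(w)=\limsup_{\bar w\to w,\,q(\bar w)\to q(w)}\hat\partial q(\bar w)$ (the limiting subdifferential, which for convex $q$ is the usual convex subdifferential). A point $w$ is a critical point of $f+g-h$ if $0\in\partial f(w)+\partial g(w)-\partial h(w)$. *)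

theory Defs
  imports "HOL-Analysis.Analysis" "HOL-Library.Landau_Symbols"
begin

text \<open>
  The Euclidean space is a type of class \<open>euclidean_space\<close>. Functions that may take the
  value \<open>+\<infinity>\<close> have codomain \<^typ>\<open>ereal\<close>; real-valued functions have codomain \<^typ>\<open>real\<close>.
\<close>

definition dom_ext :: "('a \<Rightarrow> ereal) \<Rightarrow> 'a set" where
  "dom_ext q = {w. q w < \<infinity>}"

definition proper_ext :: "('a \<Rightarrow> ereal) \<Rightarrow> bool" where
  "proper_ext q \<longleftrightarrow> (\<forall>w. q w \<noteq> -\<infinity>) \<and> dom_ext q \<noteq> {}"

text \<open>
  Only applied to functions that never take the value \<open>-\<infinity>\<close>, so that the right-hand side
  is never of the form \<open>\<infinity> - \<infinity>\<close>. The weights are positive, so \<open>0 * \<infinity>\<close> does not occur.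
\<close>
definition convex_ext :: "('a::real_vector \<Rightarrow> ereal) \<Rightarrow> bool" where
  "convex_ext q \<longleftrightarrow> (\<forall>x y. \<forall>t::real. 0 < t \<and> t < 1 \<longrightarrow>
     q ((1 - t) *\<^sub>R x + t *\<^sub>R y) \<le> ereal (1 - t) * q x + ereal t * q y)"

definition rho_convex :: "real \<Rightarrow> ('a::real_normed_vector \<Rightarrow> ereal) \<Rightarrow> bool" where
  "rho_convex \<rho> q \<longleftrightarrow> convex_ext (\<lambda>w. q w - ereal (\<rho> / 2 * (norm w)\<^sup>2))"

definition coercive :: "('a::real_normed_vector \<Rightarrow> ereal) \<Rightarrow> bool" where
  "coercive q \<longleftrightarrow> (q \<longlongrightarrow> \<infinity>) at_infinity"

text \<open>Meaningful only where \<open>q\<close> is differentiable.\<close>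
definition grad :: "('a::euclidean_space \<Rightarrow> real) \<Rightarrow> 'a \<Rightarrow> 'a" where
  "grad q w = (THE d. GDERIV q w :> d)"

definition min_fun :: "'i set \<Rightarrow> ('i \<Rightarrow> 'a \<Rightarrow> 'b::linorder) \<Rightarrow> 'a \<Rightarrow> 'b" where
  "min_fun I q w = Min ((\<lambda>i. q i w) ` I)"

definition max_fun :: "'i set \<Rightarrow> ('i \<Rightarrow> 'a \<Rightarrow> 'b::linorder) \<Rightarrow> 'a \<Rightarrow> 'b" where
  "max_fun I q w = Max ((\<lambda>i. q i w) ` I)"

text \<open>
  For the minimum or maximum \<open>q\<close> of functions \<open>p i\<close>, \<open>active_region q (p i)\<close> is
  the set \<open>D\<^sub>i(q)\<close>.
\<close>
definition active_region :: "('a \<Rightarrow> real) \<Rightarrow> ('a \<Rightarrow> real) \<Rightarrow> 'a set" where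
  "active_region q p = {w. q w = p w}"

text \<open>
  \<open>active_grads I p q w\<close> is the set \<open>q'(w)\<close>, where \<open>q\<close> is the minimum or the maximum
  of the functions \<open>p i\<close>, \<open>i \<in> I\<close>.
\<close>
definition active_grads ::
  "'i set \<Rightarrow> ('i \<Rightarrow> 'a::euclidean_space \<Rightarrow> real) \<Rightarrow> ('a \<Rightarrow> real) \<Rightarrow> 'a \<Rightarrow> 'a set" where
  "active_grads I p q w = {grad (p i) w | i. i \<in> I \<and> w \<in> active_region q (p i)}"

definition prox :: "real \<Rightarrow> ('a::euclidean_space \<Rightarrow> ereal) \<Rightarrow> 'a \<Rightarrow> 'a set" where
  "prox lam q w =
     {z. is_arg_min (\<lambda>y. q y + ereal (1 / (2 * lam) * (norm (y - w))\<^sup>2)) (\<lambda>_. True) z}"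

definition T_PDMC ::
  "real \<Rightarrow> 'i set \<Rightarrow> ('i \<Rightarrow> 'a::euclidean_space \<Rightarrow> real) \<Rightarrow> 'j set \<Rightarrow> ('j \<Rightarrow> 'a \<Rightarrow> ereal)
     \<Rightarrow> 'm set \<Rightarrow> ('m \<Rightarrow> 'a \<Rightarrow> real) \<Rightarrow> 'a \<Rightarrow> 'a set" where
  "T_PDMC lam I f J g M h w =
     (\<Union>u \<in> active_grads I f (min_fun I f) w. \<Union>v \<in> active_grads M h (max_fun M h) w.
        prox lam (min_fun J g) (w - lam *\<^sub>R u + lam *\<^sub>R v))"

definition lambda_bar :: "real \<Rightarrow> ereal" where
  "lambda_bar \<rho> = (if \<rho> < 0 then ereal (- 1 / \<rho>) else \<infinity>)"

text \<open>
  Both subdifferentials are empty at points where \<open>q\<close> is not finite, as usual in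
  variational analysis.
\<close>
definition frechet_subdiff :: "('a::euclidean_space \<Rightarrow> ereal) \<Rightarrow> 'a \<Rightarrow> 'a set" where
  "frechet_subdiff q w = {v. \<bar>q w\<bar> \<noteq> \<infinity> \<and>
     (\<exists>r. r \<in> o[at w](\<lambda>z. norm (z - w)) \<and>
        (\<forall>z. q z \<ge> q w + ereal (v \<bullet> (z - w)) + ereal (r z)))}"

text \<open>
  The upper limit of sets is the outer limit in the sense of Painleve and Kuratowski: all
  limits of sequences of Frechet subgradients along \<open>q\<close>-attentive sequences.
\<close>
definition limiting_subdiff :: "('a::euclidean_space \<Rightarrow> ereal) \<Rightarrow> 'a \<Rightarrow> 'a set" where
  "limiting_subdiff q w = {v. \<bar>q w\<bar> \<noteq> \<infinity> \<and>
     (\<exists>x u. x \<longlonglongrightarrow> w \<and> (\<lambda>k. q (x k)) \<longlonglongrightarrow> q w \<and>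
        (\<forall>k. u k \<in> frechet_subdiff q (x k)) \<and> u \<longlonglongrightarrow> v)}"

definition critical_point ::
  "('a::euclidean_space \<Rightarrow> real) \<Rightarrow> ('a \<Rightarrow> ereal) \<Rightarrow> ('a \<Rightarrow> real) \<Rightarrow> 'a \<Rightarrow> bool" where
  "critical_point f g h w \<longleftrightarrow>
     0 \<in> {a + b - c | a b c. a \<in> limiting_subdiff (\<lambda>z. ereal (f z)) w
            \<and> b \<in> limiting_subdiff g w \<and> c \<in> limiting_subdiff (\<lambda>z. ereal (h z)) w}"

end

theory Submission imports Defs
begin

text \<open>
  A fixed point \<open>w\<close> of the operator minimizes
  \<open>g + (1 / (2 * lam)) * (norm (\<cdot> - w + lam *\<^sub>R (u - v)))\<^sup>2\<close> for some active gradients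
  \<open>u\<close> of \<open>f\<close> and \<open>v\<close> of \<open>h\<close>. Hence \<open>g\<close> is minorized by a quadratic that touches it at \<open>w\<close> with
  gradient \<open>v - u\<close>, and \<open>h\<close> is minorized by an active \<open>h m\<close>, which touches it at \<open>w\<close> with
  gradient \<open>v\<close>; so these gradients are Frechet subgradients. An active \<open>f i\<close> lies above the minimum \<open>f\<close>,
  but by regularity \<open>w\<close> is a limit of interior points of the active region, where \<open>f\<close> and \<open>f i\<close>
  agree locally, so that \<open>u\<close> is a limit of gradients of \<open>f\<close>. Finally, \<open>u + (v - u) - v = 0\<close>.
\<close>

text \<open>The Riesz vector of the derivative \<open>D\<close> is \<open>adjoint D 1\<close>, and
  uniqueness of derivatives makes the description in \<open>grad\<close> well defined.\<close>

lemma differentiable_imp_GDERIV_grad: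
  fixes p :: "'a::euclidean_space \<Rightarrow> real"
  assumes "p differentiable (at x)"
  shows "GDERIV p x :> grad p x"
proof -
  obtain D where D: "(p has_derivative D) (at x)"
    using assms by (auto simp: differentiable_def)
  then have "D h = h \<bullet> adjoint D 1" for h
    using adjoint_works[OF has_derivative_linear[OF D], of h 1] by simp
  then have "D = (\<lambda>h. h \<bullet> adjoint D 1)"
    by (rule ext)
  with D have ex: "GDERIV p x :> adjoint D 1"
    by (simp add: gderiv_def)
  have "d = adjoint D 1" if "GDERIV p x :> d" for d
  proof -
    have "(\<lambda>h. h \<bullet> d) = (\<lambda>h. h \<bullet> adjoint D 1)"
      using that ex unfolding gderiv_def by (rule has_derivative_unique)
    then have "h \<bullet> d = h \<bullet> adjoint D 1" for h
      by (rule fun_cong)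
    then show ?thesis
      using vector_eq_ldot[of d "adjoint D 1"] by (simp add: inner_commute)
  qed
  with ex show ?thesis
    unfolding grad_def by (rule theI)
qed

text \<open>The first-order remainder of \<open>p\<close> at \<open>w\<close> serves as the little-o
  term for \<open>q\<close>, since \<open>q\<close> lies above \<open>p\<close> and agrees with it
  at \<open>w\<close>.\<close>

lemma GDERIV_minorant_imp_frechet_subdiff:
  fixes p :: "'a::euclidean_space \<Rightarrow> real"
  assumes deriv: "GDERIV p w :> d"
    and minorant: "\<And>z. ereal (p z) \<le> q z"
    and touch: "q w = ereal (p w)"
  shows "d \<in> frechet_subdiff q w"
proof -
  define r where "r z = p z - p w - d \<bullet> (z - w)" for z
  have "((\<lambda>z. r z / norm (z - w)) \<longlongrightarrow> 0) (at w)"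
    using deriv by (simp add: gderiv_def has_derivative_at2 r_def inner_commute diff_diff_eq)
  then have "r \<in> o[at w](\<lambda>z. norm (z - w))"
    by (rule smalloI_tendsto) (simp add: eventually_at_filter)
  moreover have "q w + ereal (d \<bullet> (z - w)) + ereal (r z) \<le> q z" for z
    using minorant[of z] by (simp add: touch r_def)
  ultimately show ?thesis
    by (auto simp: frechet_subdiff_def touch)
qed

text \<open>Constant sequences witness the limit.\<close>

lemma frechet_subdiff_subset_limiting_subdiff:
  "frechet_subdiff q w \<subseteq> limiting_subdiff q w"
proof
  fix v assume v: "v \<in> frechet_subdiff q w"
  then have "\<bar>q w\<bar> \<noteq> \<infinity>"
    by (simp add: frechet_subdiff_def)
  with v show "v \<in> limiting_subdiff q w"
    unfolding limiting_subdiff_def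
    by (intro CollectI conjI exI[of _ "\<lambda>_. w"] exI[of _ "\<lambda>_. v"]) auto
qed

lemma limiting_subdiff_of_closure_interior_active:
  fixes q p :: "'a::euclidean_space \<Rightarrow> real"
  assumes diff: "\<And>x. p differentiable (at x)"
    and cont: "continuous_on UNIV (grad p)"
    and w: "w \<in> closure (interior (active_region q p))"
    and active: "w \<in> active_region q p"
  shows "grad p w \<in> limiting_subdiff (\<lambda>z. ereal (q z)) w"
proof -
  obtain x where x: "\<And>k. x k \<in> interior (active_region q p)" and lim: "x \<longlonglongrightarrow> w"
    using w by (auto simp: closure_sequential)
  have eq: "q y = p y" if "y \<in> interior (active_region q p)" for y
    using that interior_subset by (auto simp: active_region_def)
  \<comment> \<open>Here \<open>q\<close> is its own minorant: it equals \<open>p\<close> on an open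
    set around \<open>x k\<close>, so it inherits the derivative of \<open>p\<close> there.\<close>
  have "grad p (x k) \<in> frechet_subdiff (\<lambda>z. ereal (q z)) (x k)" for k
  proof (rule GDERIV_minorant_imp_frechet_subdiff)
    have "(p has_derivative (\<lambda>h. h \<bullet> grad p (x k))) (at (x k))"
      using differentiable_imp_GDERIV_grad[OF diff] by (simp add: gderiv_def)
    then show "GDERIV q (x k) :> grad p (x k)"
      unfolding gderiv_def
      by (rule has_derivative_transform_within_open[OF _ open_interior x]) (simp add: eq)
  qed auto
  moreover have "(\<lambda>k. grad p (x k)) \<longlonglongrightarrow> grad p w"
    by (rule continuous_on_tendsto_compose[OF cont lim]) auto
  \<comment> \<open>Continuity of \<open>p\<close> suffices, because \<open>q\<close> equals
    \<open>p\<close> along the sequence and at \<open>w\<close>.\<close>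
  moreover have "(\<lambda>k. ereal (q (x k))) \<longlonglongrightarrow> ereal (q w)"
  proof -
    have "(\<lambda>k. p (x k)) \<longlonglongrightarrow> p w"
      using isCont_tendsto_compose[OF differentiable_imp_continuous_within[OF diff] lim] .
    then show ?thesis
      using active eq[OF x] by (simp add: active_region_def)
  qed
  ultimately show ?thesis
    using lim unfolding limiting_subdiff_def
    by (intro CollectI conjI exI[of _ x] exI[of _ "\<lambda>k. grad p (x k)"]) auto
qed

lemma GDERIV_quadratic:
  fixes w d :: "'a::euclidean_space"
  shows "GDERIV (\<lambda>z. a + d \<bullet> (z - w) - c * (norm (z - w))\<^sup>2) w :> d"
proof -
  \<comment> \<open>With the squared norm as an inner product, the product rule yields only terms
    containing \<open>w - w\<close>, which vanish.\<close>
  have "((\<lambda>z. a + d \<bullet> (z - w) - c * ((z - w) \<bullet> (z - w))) has_derivative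
      (\<lambda>h. (0 + d \<bullet> (h - 0)) - c * ((w - w) \<bullet> (h - 0) + (h - 0) \<bullet> (w - w)))) (at w)"
    by (intro has_derivative_diff has_derivative_add has_derivative_const has_derivative_ident
        has_derivative_inner_right has_derivative_mult_right has_derivative_inner)
  then show ?thesis
    by (simp add: gderiv_def power2_norm_eq_inner inner_commute)
qed

text \<open>Minimality of \<open>w\<close> says that \<open>q z\<close> is at least
  \<open>q w + c w - c z\<close>, with \<open>c\<close> the proximal penalty; the right-hand side is
  a smooth quadratic in \<open>z\<close> touching \<open>q\<close> at \<open>w\<close>.\<close>

lemma prox_imp_frechet_subdiff:
  fixes q :: "'a::euclidean_space \<Rightarrow> ereal"
  assumes "proper_ext q" and lam: "0 < lam" and prox: "w \<in> prox lam q (w + lam *\<^sub>R d)"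
  shows "d \<in> frechet_subdiff q w"
proof -
  define c where "c z = 1 / (2 * lam) * (norm (z - (w + lam *\<^sub>R d)))\<^sup>2" for z
  have min: "q w + ereal (c w) \<le> q z + ereal (c z)" for z
    using prox by (auto simp: prox_def is_arg_min_def c_def not_less)
  have q_bot: "q z \<noteq> -\<infinity>" for z
    using assms(1) by (simp add: proper_ext_def)
  obtain y where "q y < \<infinity>"
    using assms(1) by (auto simp: proper_ext_def dom_ext_def)
  \<comment> \<open>A competitor \<open>y\<close> with finite value forces the minimizer to have
    finite value.\<close>
  with min[of y] have "q w \<noteq> \<infinity>"
    by auto
  with q_bot[of w] obtain a where a: "q w = ereal a"
    by (cases "q w") auto
  \<comment> \<open>On expanding, the constant squares cancel, and the factor
    \<open>1 / (2 * lam)\<close> turns the cross term into the linear term with slope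
    \<open>d\<close>.\<close>
  have diff: "c w - c z = d \<bullet> (z - w) - 1 / (2 * lam) * (norm (z - w))\<^sup>2" for z
  proof -
    define y where "y = z - w"
    have c: "c w = 1 / (2 * lam) * (norm (lam *\<^sub>R d))\<^sup>2"
      "c z = 1 / (2 * lam) * (norm (y - lam *\<^sub>R d))\<^sup>2"
      by (simp_all add: c_def y_def diff_diff_eq)
    have "(norm (y - lam *\<^sub>R d))\<^sup>2 = (norm y)\<^sup>2 - 2 * lam * (d \<bullet> y) + (norm (lam *\<^sub>R d))\<^sup>2"
      unfolding power2_norm_eq_inner by (simp add: inner_diff inner_commute)
    then have "c w - c z = d \<bullet> y - 1 / (2 * lam) * (norm y)\<^sup>2"
      using lam by (simp add: c field_simps)
    then show ?thesis
      by (simp add: y_def)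
  qed
  show ?thesis
  proof (rule GDERIV_minorant_imp_frechet_subdiff[OF GDERIV_quadratic])
    show "ereal (a + d \<bullet> (z - w) - 1 / (2 * lam) * (norm (z - w))\<^sup>2) \<le> q z" for z
      using min[of z] q_bot[of z] diff[of z] by (cases "q z") (auto simp: a)
  qed (simp add: a)
qed

lemma min_fun_mem:
  assumes "finite I" "I \<noteq> {}"
  obtains i where "i \<in> I" "min_fun I q w = q i w"
proof -
  have "min_fun I q w \<in> (\<lambda>i. q i w) ` I"
    unfolding min_fun_def using assms by (intro Min_in) auto
  with that show ?thesis
    by blast
qed

lemma proper_ext_min_fun:
  assumes "finite J" "J \<noteq> {}" and "\<And>j. j \<in> J \<Longrightarrow> proper_ext (g j)"
  shows "proper_ext (min_fun J g)"
proof -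
  have "min_fun J g z \<noteq> -\<infinity>" for z
    using assms by (metis min_fun_mem proper_ext_def)
  moreover obtain j z where j: "j \<in> J" "g j z < \<infinity>"
    using assms by (fastforce simp: proper_ext_def dom_ext_def)
  moreover have "min_fun J g z \<le> g j z"
    using assms(1) j(1) by (simp add: min_fun_def)
  then have "z \<in> dom_ext (min_fun J g)"
    unfolding dom_ext_def using j(2) by (auto intro: le_less_trans)
  ultimately show ?thesis
    by (auto simp: proper_ext_def)
qed

theorem theorem5p11:
  fixes I :: "'i set" and J :: "'j set" and M :: "'m set"
    and f :: "'i \<Rightarrow> 'a::euclidean_space \<Rightarrow> real"
    and g :: "'j \<Rightarrow> 'a \<Rightarrow> ereal"
    and h :: "'m \<Rightarrow> 'a \<Rightarrow> real"
    and L :: "'i \<Rightarrow> real" and \<rho> lam :: real and w :: 'a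
  assumes "finite I" "I \<noteq> {}" "finite J" "J \<noteq> {}" "finite M" "M \<noteq> {}"
    and f_diff: "\<And>i x. i \<in> I \<Longrightarrow> f i differentiable (at x)"
    and L_pos: "\<And>i. i \<in> I \<Longrightarrow> L i > 0"
    and f_lip: "\<And>i. i \<in> I \<Longrightarrow> (L i)-lipschitz_on UNIV (grad (f i))"
    and g_proper: "\<And>j. j \<in> J \<Longrightarrow> proper_ext (g j)"
    and g_rho: "\<And>j. j \<in> J \<Longrightarrow> rho_convex \<rho> (g j)"
    and g_dom: "\<And>j. j \<in> J \<Longrightarrow> closed (dom_ext (g j))"
    and g_cont: "\<And>j. j \<in> J \<Longrightarrow> continuous_on (dom_ext (g j)) (g j)"
    and h_diff: "\<And>m x. m \<in> M \<Longrightarrow> h m differentiable (at x)"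
    and h_C1: "\<And>m. m \<in> M \<Longrightarrow> continuous_on UNIV (grad (h m))"
    and h_convex: "\<And>m. m \<in> M \<Longrightarrow> convex_on UNIV (h m)"
    and coerc: "\<And>i j m. i \<in> I \<Longrightarrow> j \<in> J \<Longrightarrow> m \<in> M \<Longrightarrow>
      coercive (\<lambda>x. ereal (f i x) + g j x - ereal (h m x))"
    and lam_pos: "0 < lam"
    and lam_less: "ereal lam < min (lambda_bar \<rho>) (ereal (1 / Max (L ` I)))"
    and regular: "\<And>i. i \<in> I \<Longrightarrow>
      active_region (min_fun I f) (f i)
        = closure (interior (active_region (min_fun I f) (f i)))"
    and fixed_pt: "w \<in> T_PDMC lam I f J g M h w"
  shows "critical_point (min_fun I f) (min_fun J g) (max_fun M h) w"
proof -
  let ?f = "min_fun I f" and ?g = "min_fun J g" and ?h = "max_fun M h"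
  obtain i m where i: "i \<in> I" "w \<in> active_region ?f (f i)"
    and m: "m \<in> M" "w \<in> active_region ?h (h m)"
    and prox: "w \<in> prox lam ?g (w - lam *\<^sub>R grad (f i) w + lam *\<^sub>R grad (h m) w)"
    using fixed_pt by (auto simp: T_PDMC_def active_grads_def)
  \<comment> \<open>The Lipschitz bound enters only as continuity of the gradient.\<close>
  have u: "grad (f i) w \<in> limiting_subdiff (\<lambda>z. ereal (?f z)) w"
    using limiting_subdiff_of_closure_interior_active
      [OF f_diff[OF i(1)] lipschitz_on_continuous_on[OF f_lip[OF i(1)]] _ i(2)]
      regular[OF i(1)] i(2) by simp
  have "grad (h m) w - grad (f i) w \<in> frechet_subdiff ?g w"
  proof (rule prox_imp_frechet_subdiff[OF _ lam_pos])
    show "proper_ext ?g"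
      using assms(3,4) g_proper by (rule proper_ext_min_fun)
    show "w \<in> prox lam ?g (w + lam *\<^sub>R (grad (h m) w - grad (f i) w))"
      using prox by (simp add: algebra_simps)
  qed
  then have b: "grad (h m) w - grad (f i) w \<in> limiting_subdiff ?g w"
    using frechet_subdiff_subset_limiting_subdiff by blast
  \<comment> \<open>Unlike for the minimum \<open>?f\<close>, an active piece of the maximum is a
    minorant, so no limit of nearby gradients is taken.\<close>
  have "grad (h m) w \<in> frechet_subdiff (\<lambda>z. ereal (?h z)) w"
  proof (rule GDERIV_minorant_imp_frechet_subdiff)
    show "GDERIV (h m) w :> grad (h m) w"
      using h_diff[OF m(1)] by (rule differentiable_imp_GDERIV_grad)
    show "ereal (h m z) \<le> ereal (?h z)" for z
      using \<open>finite M\<close> m(1) by (simp add: max_fun_def)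
    show "ereal (?h w) = ereal (h m w)"
      using m(2) by (simp add: active_region_def)
  qed
  then have v: "grad (h m) w \<in> limiting_subdiff (\<lambda>z. ereal (?h z)) w"
    using frechet_subdiff_subset_limiting_subdiff by blast
  have "0 = grad (f i) w + (grad (h m) w - grad (f i) w) - grad (h m) w"
    by simp
  with u b v show ?thesis
    unfolding critical_point_def by blast
qed

end
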